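(* Let $(M,L)$ be a Finsler manifold with Finsler metric $g$ and Cartan connection $\nabla$. If a $\pi$-vector field $\overline{X}$ is $\overline{d}$-closed, then the $\pi$-distribution $\mathfrak{D}$ generated by $\overline{X}$ is $h$-involutive (with respect to $\nabla$).
   Context: All objects are $C^\infty$. $M$ is an $n$-dimensional manifold, $\mathcal{T}M$ is the bundle of nonzero tangent vectors, $\pi:\mathcal{T}M\to M$ the projection, and $P:\pi^{-1}(TM)\to\mathcal{T}M$ the pullback of $TM$ by $\pi$, with fibre $P^{-1}(u)=\{u\}\times T_{\pi(u)}M$. Its sections are called $\pi$-vector fields; tensor fields (forms) on $\pi^{-1}(TM)$ are called $\pi$-tensor fields ($\pi$-forms). A Finsler structure $L$ on $M$ is positive and smooth on $\mathcal{T}M$, positively homogeneous of degree 1 on fibres, and the fibrewise Hessian $g$ of $\frac12L^2$, a metric on $\pi^{-1}(TM)$ called the Finsler metric, is positive definite. The fundamental $\pi$-vector field is $\overline{\eta}(u)=(u,u)$. Let $\rho:T(\mathcal{T}M)\to\pi^{-1}(TM)$, $\rho(X)=(u,d\pi(X))$ for $X\in T_u(\mathcal{T}M)$, and $\gamma:\pi^{-1}(TM)\to T(\mathcal{T}M)$, $\gamma(u,v)=\frac{d}{dt}\big|_{t=0}(u+tv)$. For a linear connection $\nabla$ in $\pi^{-1}(TM)$, its connection map is $K(X)=\nabla_X\overline{\eta}$; $\nabla$ is regular if $T(\mathcal{T}M)=V(\mathcal{T}M)\oplus H(\mathcal{T}M)$, where $V(\mathcal TM)=\ker\rho$ and $H(\mathcal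 TM)=\ker K$. For regular $\nabla$ set $\beta=(\rho|_{H(\mathcal{T}M)})^{-1}$. The torsion is $\mathbf{T}(X,Y)=\nabla_X\rho Y-\nabla_Y\rho X-\rho[X,Y]$, with $Q(\overline{X},\overline{Y})=\mathbf{T}(\beta\overline{X},\beta\overline{Y})$ and $T(\overline{X},\overline{Y})=\mathbf{T}(\gamma\overline{X},\beta\overline{Y})$. The Cartan connection of $(M,L)$ is the unique regular connection $\nabla$ in $\pi^{-1}(TM)$ with $\nabla g=0$, $Q=0$ and $g(T(\overline{X},\overline{Y}),\overline{Z})=g(T(\overline{X},\overline{Z}),\overline{Y})$; $\beta$ below refers to it. For a 1-$\pi$-form $\omega$, $(\overline{d}\omega)(\overline{Y},\overline{Z})=\beta\overline{Y}\cdot\omega(\overline{Z})-\beta\overline{Z}\cdot\omega(\overline{Y})-\omega(\rho[\beta\overline{Y},\beta\overline{Z}])$. A $\pi$-vector field $\overline{X}$ is $\overline{d}$-closed if $\overline{d}(i_{\overline{X}}g)=0$, where $i_{\overline{X}}g=g(\overline{X},\cdot)$. The $\pi$-distribution generated by a $\pi$-vector field $\overline{X}$ is the assignment $u\mapsto\mathfrak{D}_u=\{\overline{Y}\in P^{-1}(u): g(\overline{X}(u),\overline{Y})=0\}$ (of dimension $n-1$ where $\overline{X}\neq0$). A $\pi$-vector field $\overline{Y}$ belongs to $\mathfrak{D}$ if $\overline{Y}(u)\in\mathfrak{D}_u$ for every $u$. $\mathfrak{D}$ is $h$-involutive if $\rho[\beta\overline{Y},\beta\overline{Z}]$ belongs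 to $\mathfrak{D}$ whenever $\pi$-vector fields $\overline{Y},\overline{Z}$ belong to $\mathfrak{D}$. *)

theory Defs
  imports "HOL-Analysis.Analysis"
begin

section \<open>Smooth functions and manifolds\<close>

text \<open>\<open>Ck_on k S f\<close> is meant for open \<open>S\<close>; the values of \<open>f\<close> outside \<open>S\<close> are then irrelevant.\<close>

primrec Ck_on :: "nat \<Rightarrow> 'e::euclidean_space set \<Rightarrow> ('e \<Rightarrow> 'b::real_normed_vector) \<Rightarrow> bool" where
  "Ck_on 0 S f \<longleftrightarrow> continuous_on S f"
| "Ck_on (Suc k) S f \<longleftrightarrow> (\<forall>x\<in>S. f differentiable (at x)) \<and>
     (\<forall>v. Ck_on k S (\<lambda>x. frechet_derivative f (at x) v))"

definition smooth_on :: "'e::euclidean_space set \<Rightarrow> ('e \<Rightarrow> 'b::real_normed_vector) \<Rightarrow> bool" where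
  "smooth_on S f \<longleftrightarrow> (\<forall>k. Ck_on k S f)"

type_synonym ('a, 'e) chart = "'a set \<times> ('a \<Rightarrow> 'e)"

text \<open>Manifolds of dimension \<open>n = DIM('e)\<close>, with an atlas that need not be maximal.\<close>

locale smooth_manifold =
  fixes M :: "'a topology" and A :: "('a, 'e::euclidean_space) chart set"
  assumes Hausdorff: "Hausdorff_space M"
    and second_countable: "second_countable M"
    and chart_domain: "(U, \<phi>) \<in> A \<Longrightarrow> openin M U"
    and chart_image: "(U, \<phi>) \<in> A \<Longrightarrow> open (\<phi> ` U)"
    and chart_homeo: "(U, \<phi>) \<in> A \<Longrightarrow>
      homeomorphic_map (subtopology M U) (top_of_set (\<phi> ` U)) \<phi>"
    and chart_cover: "\<Union> (fst ` A) = topspace M"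
    and chart_compatible: "(U, \<phi>) \<in> A \<Longrightarrow> (V, \<psi>) \<in> A \<Longrightarrow>
      smooth_on (\<phi> ` (U \<inter> V)) (\<psi> \<circ> inv_into U \<phi>)"

text \<open>The notions below only refer to the atlas, and to the set \<open>points A\<close> that it covers.
  \<open>smooth_at A f p\<close> says that \<open>f\<close> is \<open>C\<^sup>\<infinity>\<close> on some neighbourhood of \<open>p\<close>; functions are total on
  the type \<open>'a\<close>, but only their values near \<open>p\<close> matter.\<close>

definition points :: "('a, 'e) chart set \<Rightarrow> 'a set" where
  "points A = \<Union> (fst ` A)"

definition smooth_at :: "('a, 'e::euclidean_space) chart set \<Rightarrow> ('a \<Rightarrow> real) \<Rightarrow> 'a \<Rightarrow> bool" where
  "smooth_at A f p \<longleftrightarrow> (\<forall>(U, \<phi>)\<in>A. p \<in> U \<longrightarrow>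
     (\<exists>W. open W \<and> \<phi> p \<in> W \<and> W \<subseteq> \<phi> ` U \<and> smooth_on W (f \<circ> inv_into U \<phi>)))"

text \<open>Tangent vectors are derivations of the functions that are smooth near \<open>p\<close>.  They are
  set to \<open>0\<close> on all other functions, so that equality of tangent vectors is equality in HOL.
  They are local: if \<open>f = 0\<close> near \<open>p\<close> then \<open>f = h f\<close> for the indicator function \<open>h\<close> of
  \<open>f \<noteq> 0\<close>, and \<open>v f = h p * v f + f p * v h = 0\<close>.\<close>

type_synonym 'a tvec = "('a \<Rightarrow> real) \<Rightarrow> real"

definition tangent_space :: "('a, 'e::euclidean_space) chart set \<Rightarrow> 'a \<Rightarrow> 'a tvec set" where
  "tangent_space A p = {v.
     (\<forall>f g. smooth_at A f p \<longrightarrow> smooth_at A g p \<longrightarrow> v (\<lambda>q. f q + g q) = v f + v g) \<and>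
     (\<forall>c f. smooth_at A f p \<longrightarrow> v (\<lambda>q. c * f q) = c * v f) \<and>
     (\<forall>f g. smooth_at A f p \<longrightarrow> smooth_at A g p \<longrightarrow> v (\<lambda>q. f q * g q) = f p * v g + g p * v f) \<and>
     (\<forall>f. \<not> smooth_at A f p \<longrightarrow> v f = 0)}"

text \<open>Velocity at time \<open>0\<close> of a curve \<open>c\<close>, and the tangent map at \<open>q\<close> of a map \<open>F\<close> into the
  manifold with atlas \<open>A\<close>.\<close>

definition velocity :: "('a, 'e::euclidean_space) chart set \<Rightarrow> (real \<Rightarrow> 'a) \<Rightarrow> 'a tvec" where
  "velocity A c = (\<lambda>f. if smooth_at A f (c 0) then deriv (\<lambda>t. f (c t)) 0 else 0)"

definition tangent_map ::
  "('a, 'e::euclidean_space) chart set \<Rightarrow> ('b \<Rightarrow> 'a) \<Rightarrow> 'b \<Rightarrow> 'b tvec \<Rightarrow> 'a tvec" where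
  "tangent_map A F q \<xi> = (\<lambda>f. if smooth_at A f (F q) then \<xi> (f \<circ> F) else 0)"

text \<open>Smooth vector fields along a map \<open>F\<close> from the manifold with atlas \<open>B\<close> to the one with
  atlas \<open>A\<close>, that is, smooth sections of the pullback by \<open>F\<close> of the tangent bundle.  Smoothness is
  expressed by the action on functions; on the coordinate functions of a chart this gives
  the components of the section in the corresponding local trivialization.\<close>

definition vector_field_along ::
  "('b, 'd::euclidean_space) chart set \<Rightarrow> ('a, 'e::euclidean_space) chart set \<Rightarrow>
    ('b \<Rightarrow> 'a) \<Rightarrow> ('b \<Rightarrow> 'a tvec) \<Rightarrow> bool" where
  "vector_field_along B A F X \<longleftrightarrow> (\<forall>q\<in>points B. X q \<in> tangent_space A (F q) \<and>
     (\<forall>f. smooth_at A f (F q) \<longrightarrow> smooth_at B (\<lambda>r. X r f) q))"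

definition vector_field :: "('a, 'e::euclidean_space) chart set \<Rightarrow> ('a \<Rightarrow> 'a tvec) \<Rightarrow> bool" where
  "vector_field A X \<longleftrightarrow> vector_field_along A A (\<lambda>p. p) X"

definition lie_bracket ::
  "('a, 'e::euclidean_space) chart set \<Rightarrow> ('a \<Rightarrow> 'a tvec) \<Rightarrow> ('a \<Rightarrow> 'a tvec) \<Rightarrow> 'a \<Rightarrow> 'a tvec" where
  "lie_bracket A X Y p =
     (\<lambda>f. if smooth_at A f p then X p (\<lambda>q. Y q f) - Y p (\<lambda>q. X q f) else 0)"


section \<open>The bundle of nonzero tangent vectors\<close>

text \<open>A tangent vector together with its base point; the projection \<open>\<pi>\<close> is \<open>fst\<close>.\<close>

type_synonym 'a tpoint = "'a \<times> 'a tvec"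

text \<open>The chart \<open>(U, \<phi>)\<close> induces the chart \<open>(x\<^sup>i, y\<^sup>i)\<close> with \<open>x\<^sup>i = \<phi>\<^sup>i p\<close> and \<open>y\<^sup>i = v \<phi>\<^sup>i\<close>.\<close>

fun slit_chart ::
  "('a, 'e::euclidean_space) chart set \<Rightarrow> ('a, 'e) chart \<Rightarrow> ('a tpoint, 'e \<times> 'e) chart" where
  "slit_chart A (U, \<phi>) =
     ({(p, v). p \<in> U \<and> v \<in> tangent_space A p \<and> v \<noteq> (\<lambda>_. 0)},
      \<lambda>(p, v). (\<phi> p, \<Sum>i\<in>Basis. v (\<lambda>q. \<phi> q \<bullet> i) *\<^sub>R i))"

definition slit_atlas ::
  "('a, 'e::euclidean_space) chart set \<Rightarrow> ('a tpoint, 'e \<times> 'e) chart set" where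
  "slit_atlas A = slit_chart A ` A"

definition slit_bundle :: "('a, 'e::euclidean_space) chart set \<Rightarrow> 'a tpoint set" where
  "slit_bundle A = {(p, v). p \<in> points A \<and> v \<in> tangent_space A p \<and> v \<noteq> (\<lambda>_. 0)}"

lemma points_slit_atlas: "points (slit_atlas A) = slit_bundle A"
  by (force simp: points_def slit_atlas_def slit_bundle_def)

text \<open>An element \<open>(u, w)\<close> of the pullback bundle over \<open>u\<close> is represented by
  \<open>w \<in> tangent_space A (fst u)\<close>, and a section \<open>u \<mapsto> (u, X u)\<close> by \<open>X\<close>.\<close>

type_synonym 'a pi_field = "'a tpoint \<Rightarrow> 'a tvec"

definition pi_vector_field :: "('a, 'e::euclidean_space) chart set \<Rightarrow> 'a pi_field \<Rightarrow> bool" where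
  "pi_vector_field A X \<longleftrightarrow> vector_field_along (slit_atlas A) A fst X"

definition fundamental_field :: "'a pi_field" where
  "fundamental_field u = snd u"

definition rho ::
  "('a, 'e::euclidean_space) chart set \<Rightarrow> 'a tpoint \<Rightarrow> 'a tpoint tvec \<Rightarrow> 'a tvec" where
  "rho A u \<xi> = tangent_map A fst u \<xi>"

definition gamma ::
  "('a, 'e::euclidean_space) chart set \<Rightarrow> 'a tpoint \<Rightarrow> 'a tvec \<Rightarrow> 'a tpoint tvec" where
  "gamma A u w = velocity (slit_atlas A) (\<lambda>t. (fst u, \<lambda>f. snd u f + t * w f))"


section \<open>Finsler structures\<close>

text \<open>The Hessian at \<open>u = (p, v)\<close> of \<open>L\<^sup>2 / 2\<close> on the fibre over \<open>p\<close>.\<close>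

definition finsler_metric :: "('a tpoint \<Rightarrow> real) \<Rightarrow> 'a tpoint \<Rightarrow> 'a tvec \<Rightarrow> 'a tvec \<Rightarrow> real" where
  "finsler_metric L u a b =
     deriv (\<lambda>s. deriv (\<lambda>t. (L (fst u, \<lambda>f. snd u f + s * a f + t * b f))\<^sup>2 / 2) 0) 0"

locale finsler_manifold = smooth_manifold M A
  for M :: "'a topology" and A :: "('a, 'e::euclidean_space) chart set" +
  fixes L :: "'a tpoint \<Rightarrow> real"
  assumes L_pos: "u \<in> slit_bundle A \<Longrightarrow> L u > 0"
    and L_smooth: "u \<in> slit_bundle A \<Longrightarrow> smooth_at (slit_atlas A) L u"
    and L_homogeneous: "(p, v) \<in> slit_bundle A \<Longrightarrow> c > 0 \<Longrightarrow> L (p, \<lambda>f. c * v f) = c * L (p, v)"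
    and metric_pos_def: "u \<in> slit_bundle A \<Longrightarrow> a \<in> tangent_space A (fst u) \<Longrightarrow> a \<noteq> (\<lambda>_. 0) \<Longrightarrow>
      finsler_metric L u a a > 0"


section \<open>Linear connections in the pullback bundle\<close>

text \<open>\<open>D u \<xi> Y\<close> is the covariant derivative at \<open>u\<close> of the section \<open>Y\<close> in the direction of the
  tangent vector \<open>\<xi>\<close> of the slit bundle at \<open>u\<close>.  As for tangent vectors, the Leibniz rule implies
  that it does not depend on the values of \<open>Y\<close> outside the slit bundle.\<close>

type_synonym 'a pi_connection = "'a tpoint \<Rightarrow> 'a tpoint tvec \<Rightarrow> 'a pi_field \<Rightarrow> 'a tvec"

definition linear_connection ::
  "('a, 'e::euclidean_space) chart set \<Rightarrow> 'a pi_connection \<Rightarrow> bool" where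
  "linear_connection A D \<longleftrightarrow>
     (\<forall>u\<in>slit_bundle A. \<forall>\<xi>\<in>tangent_space (slit_atlas A) u. \<forall>Y. pi_vector_field A Y \<longrightarrow>
        D u \<xi> Y \<in> tangent_space A (fst u)) \<and>
     (\<forall>u\<in>slit_bundle A. \<forall>\<xi>\<in>tangent_space (slit_atlas A) u. \<forall>\<zeta>\<in>tangent_space (slit_atlas A) u.
        \<forall>Y. pi_vector_field A Y \<longrightarrow>
        D u (\<lambda>h. \<xi> h + \<zeta> h) Y = (\<lambda>f. D u \<xi> Y f + D u \<zeta> Y f)) \<and>
     (\<forall>u\<in>slit_bundle A. \<forall>\<xi>\<in>tangent_space (slit_atlas A) u. \<forall>c Y. pi_vector_field A Y \<longrightarrow>
        D u (\<lambda>h. c * \<xi> h) Y = (\<lambda>f. c * D u \<xi> Y f)) \<and>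
     (\<forall>u\<in>slit_bundle A. \<forall>\<xi>\<in>tangent_space (slit_atlas A) u. \<forall>Y Z.
        pi_vector_field A Y \<longrightarrow> pi_vector_field A Z \<longrightarrow>
        D u \<xi> (\<lambda>w f. Y w f + Z w f) = (\<lambda>f. D u \<xi> Y f + D u \<xi> Z f)) \<and>
     (\<forall>u\<in>slit_bundle A. \<forall>\<xi>\<in>tangent_space (slit_atlas A) u. \<forall>h Y.
        (\<forall>w\<in>slit_bundle A. smooth_at (slit_atlas A) h w) \<longrightarrow> pi_vector_field A Y \<longrightarrow>
        D u \<xi> (\<lambda>w f. h w * Y w f) = (\<lambda>f. \<xi> h * Y u f + h u * D u \<xi> Y f)) \<and>
     (\<forall>X Y. vector_field (slit_atlas A) X \<longrightarrow> pi_vector_field A Y \<longrightarrow>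
        pi_vector_field A (\<lambda>u. D u (X u) Y))"

definition connection_map :: "'a pi_connection \<Rightarrow> 'a tpoint \<Rightarrow> 'a tpoint tvec \<Rightarrow> 'a tvec" where
  "connection_map D u \<xi> = D u \<xi> fundamental_field"

definition vertical_space ::
  "('a, 'e::euclidean_space) chart set \<Rightarrow> 'a tpoint \<Rightarrow> 'a tpoint tvec set" where
  "vertical_space A u = {\<xi> \<in> tangent_space (slit_atlas A) u. rho A u \<xi> = (\<lambda>_. 0)}"

definition horizontal_space ::
  "('a, 'e::euclidean_space) chart set \<Rightarrow> 'a pi_connection \<Rightarrow> 'a tpoint \<Rightarrow> 'a tpoint tvec set" where
  "horizontal_space A D u =
     {\<xi> \<in> tangent_space (slit_atlas A) u. connection_map D u \<xi> = (\<lambda>_. 0)}"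

definition regular_connection ::
  "('a, 'e::euclidean_space) chart set \<Rightarrow> 'a pi_connection \<Rightarrow> bool" where
  "regular_connection A D \<longleftrightarrow> linear_connection A D \<and> (\<forall>u\<in>slit_bundle A.
     vertical_space A u \<inter> horizontal_space A D u = {\<lambda>_. 0} \<and>
     tangent_space (slit_atlas A) u =
       {\<lambda>h. \<xi> h + \<zeta> h | \<xi> \<zeta>. \<xi> \<in> vertical_space A u \<and> \<zeta> \<in> horizontal_space A D u})"

definition beta ::
  "('a, 'e::euclidean_space) chart set \<Rightarrow> 'a pi_connection \<Rightarrow> 'a tpoint \<Rightarrow> 'a tvec \<Rightarrow> 'a tpoint tvec"
  where "beta A D u = inv_into (horizontal_space A D u) (rho A u)"

definition torsion ::
  "('a, 'e::euclidean_space) chart set \<Rightarrow> 'a pi_connection \<Rightarrow>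
    ('a tpoint \<Rightarrow> 'a tpoint tvec) \<Rightarrow> ('a tpoint \<Rightarrow> 'a tpoint tvec) \<Rightarrow> 'a pi_field" where
  "torsion A D X Y u =
     (\<lambda>f. D u (X u) (\<lambda>w. rho A w (Y w)) f - D u (Y u) (\<lambda>w. rho A w (X w)) f
        - rho A u (lie_bracket (slit_atlas A) X Y u) f)"

definition torsion_hh ::
  "('a, 'e::euclidean_space) chart set \<Rightarrow> 'a pi_connection \<Rightarrow> 'a pi_field \<Rightarrow> 'a pi_field \<Rightarrow> 'a pi_field"
  where "torsion_hh A D X Y = torsion A D (\<lambda>u. beta A D u (X u)) (\<lambda>u. beta A D u (Y u))"

definition torsion_vh ::
  "('a, 'e::euclidean_space) chart set \<Rightarrow> 'a pi_connection \<Rightarrow> 'a pi_field \<Rightarrow> 'a pi_field \<Rightarrow> 'a pi_field"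
  where "torsion_vh A D X Y = torsion A D (\<lambda>u. gamma A u (X u)) (\<lambda>u. beta A D u (Y u))"

definition metric_connection ::
  "('a, 'e::euclidean_space) chart set \<Rightarrow> ('a tpoint \<Rightarrow> real) \<Rightarrow> 'a pi_connection \<Rightarrow> bool" where
  "metric_connection A L D \<longleftrightarrow>
     (\<forall>Y Z. pi_vector_field A Y \<longrightarrow> pi_vector_field A Z \<longrightarrow>
       (\<forall>u\<in>slit_bundle A. \<forall>\<xi>\<in>tangent_space (slit_atlas A) u.
         \<xi> (\<lambda>w. finsler_metric L w (Y w) (Z w)) =
           finsler_metric L u (D u \<xi> Y) (Z u) + finsler_metric L u (Y u) (D u \<xi> Z)))"

definition cartan_connection ::
  "('a, 'e::euclidean_space) chart set \<Rightarrow> ('a tpoint \<Rightarrow> real) \<Rightarrow> 'a pi_connection \<Rightarrow> bool" where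
  "cartan_connection A L D \<longleftrightarrow> regular_connection A D \<and> metric_connection A L D \<and>
     (\<forall>X Y. pi_vector_field A X \<longrightarrow> pi_vector_field A Y \<longrightarrow>
       (\<forall>u\<in>slit_bundle A. torsion_hh A D X Y u = (\<lambda>_. 0))) \<and>
     (\<forall>X Y Z. pi_vector_field A X \<longrightarrow> pi_vector_field A Y \<longrightarrow> pi_vector_field A Z \<longrightarrow>
       (\<forall>u\<in>slit_bundle A. finsler_metric L u (torsion_vh A D X Y u) (Z u) =
                          finsler_metric L u (torsion_vh A D X Z u) (Y u)))"


section \<open>Closed fields and involutive distributions\<close>

definition dbar ::
  "('a, 'e::euclidean_space) chart set \<Rightarrow> 'a pi_connection \<Rightarrow>
    ('a tpoint \<Rightarrow> 'a tvec \<Rightarrow> real) \<Rightarrow> 'a pi_field \<Rightarrow> 'a pi_field \<Rightarrow> 'a tpoint \<Rightarrow> real" where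
  "dbar A D \<omega> Y Z u =
     beta A D u (Y u) (\<lambda>w. \<omega> w (Z w)) - beta A D u (Z u) (\<lambda>w. \<omega> w (Y w))
     - \<omega> u (rho A u (lie_bracket (slit_atlas A)
                       (\<lambda>w. beta A D w (Y w)) (\<lambda>w. beta A D w (Z w)) u))"

definition dbar_closed ::
  "('a, 'e::euclidean_space) chart set \<Rightarrow> ('a tpoint \<Rightarrow> real) \<Rightarrow> 'a pi_connection \<Rightarrow> 'a pi_field \<Rightarrow> bool"
  where "dbar_closed A L D X \<longleftrightarrow>
     (\<forall>Y Z. pi_vector_field A Y \<longrightarrow> pi_vector_field A Z \<longrightarrow>
       (\<forall>u\<in>slit_bundle A. dbar A D (\<lambda>w. finsler_metric L w (X w)) Y Z u = 0))"

definition pi_distribution ::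
  "('a, 'e::euclidean_space) chart set \<Rightarrow> ('a tpoint \<Rightarrow> real) \<Rightarrow> 'a pi_field \<Rightarrow> 'a tpoint \<Rightarrow> 'a tvec set"
  where "pi_distribution A L X u =
     {w \<in> tangent_space A (fst u). finsler_metric L u (X u) w = 0}"

definition belongs_to ::
  "('a, 'e::euclidean_space) chart set \<Rightarrow> 'a pi_field \<Rightarrow> ('a tpoint \<Rightarrow> 'a tvec set) \<Rightarrow> bool" where
  "belongs_to A Y \<D> \<longleftrightarrow> (\<forall>u\<in>slit_bundle A. Y u \<in> \<D> u)"

definition h_involutive ::
  "('a, 'e::euclidean_space) chart set \<Rightarrow> 'a pi_connection \<Rightarrow> ('a tpoint \<Rightarrow> 'a tvec set) \<Rightarrow> bool" where
  "h_involutive A D \<D> \<longleftrightarrow>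
     (\<forall>Y Z. pi_vector_field A Y \<longrightarrow> pi_vector_field A Z \<longrightarrow>
       belongs_to A Y \<D> \<longrightarrow> belongs_to A Z \<D> \<longrightarrow>
       belongs_to A (\<lambda>u. rho A u (lie_bracket (slit_atlas A)
                       (\<lambda>w. beta A D w (Y w)) (\<lambda>w. beta A D w (Z w)) u)) \<D>)"

end

(*
The identity (dbar omega)(Y, Z) = 0 for omega = g(X, .) and Y, Z orthogonal to X reads
g(X, rho[beta Y, beta Z]) = 0, because beta Y and beta Z are derivations and the functions
g(X, Z) and g(X, Y) vanish on the whole slit bundle.  That rho[beta Y, beta Z] is again a tangent
vector follows from Q = 0, which writes it as a difference of covariant derivatives.  Both steps
need beta to be a genuine right inverse of rho, hence that every tangent vector of M lifts to the
slit bundle; as tangent vectors are derivations, this is where Hadamard's lemma enters.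
*)
theory Submission
  imports Defs
begin

section \<open>Calculus of smooth functions\<close>

text \<open>Orthogonality to \<open>X\<close> is only half of membership in the distribution; the
  other half is tangency of \<open>rho\<close> of the bracket. A direct proof of tangency would
  first have to show that horizontal lifts are smooth vector fields on the slit bundle. The torsion
  identity bypasses this: a covariant derivative is a tangent vector pointwise, by the definition of
  a connection.

  The obstacle is then \<open>beta\<close>. Being an \<open>inv_into\<close>, it means something
  only on the image of the horizontal space under \<open>rho\<close>. Regularity splits the tangent
  space of the slit bundle, but whether \<open>rho\<close> reaches a given vector \<open>w\<close>
  has to be shown. A lift is therefore built in a slit chart, as a directional derivative. That it
  projects to \<open>w\<close>, and not merely to some vector with the same components, requires
  that a derivation be determined by its values on coordinate functions.

  Functions are total, so everything known about them holds only on the covered points; locality of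
  derivations has to bridge that gap each time.\<close>

lemma Ck_on_cong:
  assumes "open S" "\<And>x. x \<in> S \<Longrightarrow> f x = g x" "Ck_on k S f"
  shows "Ck_on k S g"
  using assms(2,3)
proof (induction k arbitrary: f g)
  case 0
  then show ?case using continuous_on_eq by (metis Ck_on.simps(1))
next
  case (Suc k)
  have d: "(g has_derivative frechet_derivative f (at x)) (at x)" if "x \<in> S" for x
  proof -
    have "(f has_derivative frechet_derivative f (at x)) (at x)"
      using Suc.prems(2) that frechet_derivative_works by auto
    then show ?thesis
      using has_derivative_transform_within_open assms(1) that Suc.prems(1) by blast
  qed
  then have e: "frechet_derivative f (at x) = frechet_derivative g (at x)" if "x \<in> S" for x
    using that frechet_derivative_at by blast
  have "Ck_on k S (\<lambda>x. frechet_derivative g (at x) v)" for v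
    using Suc.IH[of "\<lambda>x. frechet_derivative f (at x) v"] Suc.prems(2) e by simp
  then show ?case using d by (auto intro: differentiableI)
qed

text \<open>Uniqueness of the derivative on an open set lets an explicit formula \<open>f'\<close>
  stand in for \<open>frechet_derivative\<close>; the inductions for sums, products and composites
  go through this rule.\<close>

lemma Ck_on_SucI:
  assumes "open S" "\<And>x. x \<in> S \<Longrightarrow> (f has_derivative f' x) (at x)"
    and "\<And>v. Ck_on k S (\<lambda>x. f' x v)"
  shows "Ck_on (Suc k) S f"
proof -
  have "f' x = frechet_derivative f (at x)" if "x \<in> S" for x
    using assms(2)[OF that] frechet_derivative_at by blast
  then have "Ck_on k S (\<lambda>x. frechet_derivative f (at x) v)" for v
    using Ck_on_cong[OF assms(1) _ assms(3)[of v]] by simp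
  then show ?thesis using assms(2) by (auto intro: differentiableI)
qed

lemma Ck_on_Suc_has_derivative:
  assumes "Ck_on (Suc k) S f" "x \<in> S"
  shows "(f has_derivative frechet_derivative f (at x)) (at x)"
  using assms frechet_derivative_works by auto

text \<open>Needed for the product and chain rules, where the undifferentiated functions reappear
  next to the derivatives, one order lower.\<close>

lemma Ck_on_SucD: "Ck_on (Suc k) S f \<Longrightarrow> Ck_on k S f"
proof (induction k arbitrary: f)
  case 0
  then show ?case
    by (auto intro!: continuous_at_imp_continuous_on differentiable_imp_continuous_within)
next
  case (Suc k)
  then show ?case by (meson Ck_on.simps(2))
qed

lemma Ck_on_subset: "Ck_on k S f \<Longrightarrow> T \<subseteq> S \<Longrightarrow> Ck_on k T f"
  by (induction k arbitrary: f) (auto intro: continuous_on_subset)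

lemma Ck_on_const: "open S \<Longrightarrow> Ck_on k S (\<lambda>x. c)"
proof (induction k arbitrary: c)
  case (Suc k)
  show ?case by (rule Ck_on_SucI[where f' = "\<lambda>x v. 0"]) (use Suc in auto)
qed auto

lemma Ck_on_bounded_linear_compose:
  assumes "bounded_linear h" "open S" "Ck_on k S f"
  shows "Ck_on k S (\<lambda>x. h (f x))"
  using assms(3)
proof (induction k arbitrary: f)
  case 0
  then show ?case using assms(1) by (auto intro: bounded_linear.continuous_on)
next
  case (Suc k)
  show ?case
    by (rule Ck_on_SucI[where f' = "\<lambda>x v. h (frechet_derivative f (at x) v)"])
      (use Suc assms in \<open>auto intro!: bounded_linear.has_derivative[OF assms(1)]
        simp: frechet_derivative_works[symmetric]\<close>)
qed

lemma Ck_on_bounded_linear: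
  assumes "bounded_linear h" "open S"
  shows "Ck_on k S h"
proof (cases k)
  case 0
  then show ?thesis using assms(1) by (simp add: linear_continuous_on)
next
  case (Suc k)
  then show ?thesis
    using Ck_on_SucI[where f' = "\<lambda>x. h", OF assms(2) bounded_linear_imp_has_derivative]
      Ck_on_const assms by blast
qed

lemma Ck_on_add:
  assumes "open S" "Ck_on k S f" "Ck_on k S g"
  shows "Ck_on k S (\<lambda>x. f x + g x)"
  using assms(2,3)
proof (induction k arbitrary: f g)
  case 0
  then show ?case by (auto intro: continuous_on_add)
next
  case (Suc k)
  show ?case
    by (rule Ck_on_SucI[where
          f' = "\<lambda>x v. frechet_derivative f (at x) v + frechet_derivative g (at x) v"])
      (use Suc assms(1) in \<open>auto intro!: has_derivative_add
        simp: frechet_derivative_works[symmetric]\<close>)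
qed

lemma Ck_on_sum:
  assumes "open S" "\<And>i. i \<in> I \<Longrightarrow> Ck_on k S (f i)"
  shows "Ck_on k S (\<lambda>x. \<Sum>i\<in>I. f i x)"
  using assms(2)
proof (induction I rule: infinite_finite_induct)
  case (insert i I)
  then have "Ck_on k S (\<lambda>x. f i x + (\<Sum>i\<in>I. f i x))" by (intro Ck_on_add assms(1)) auto
  then show ?case using insert by simp
qed (simp_all add: Ck_on_const assms(1))

lemma Ck_on_scaleR:
  fixes f :: "_ \<Rightarrow> real"
  assumes "open S" "Ck_on k S f" "Ck_on k S g"
  shows "Ck_on k S (\<lambda>x. f x *\<^sub>R g x)"
  using assms(2,3)
proof (induction k arbitrary: f g)
  case 0
  then show ?case by (auto intro: continuous_on_scaleR)
next
  case (Suc k)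
  show ?case
  proof (rule Ck_on_SucI[OF assms(1)])
    show "((\<lambda>x. f x *\<^sub>R g x) has_derivative
        (\<lambda>v. f x *\<^sub>R frechet_derivative g (at x) v + frechet_derivative f (at x) v *\<^sub>R g x)) (at x)"
      if "x \<in> S" for x
      by (rule has_derivative_scaleR) (use Suc.prems that Ck_on_Suc_has_derivative in blast)+
    show "Ck_on k S (\<lambda>x. f x *\<^sub>R frechet_derivative g (at x) v
        + frechet_derivative f (at x) v *\<^sub>R g x)" for v
      using Suc.prems Ck_on_SucD[OF Suc.prems(1)] Ck_on_SucD[OF Suc.prems(2)]
      by (intro Ck_on_add assms(1) Suc.IH) auto
  qed
qed

lemma linear_eq_sum_Basis:
  fixes h :: "'e::euclidean_space \<Rightarrow> 'b::real_vector"
  assumes "linear h"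
  shows "h v = (\<Sum>j\<in>Basis. (v \<bullet> j) *\<^sub>R h j)"
proof -
  have "h v = h (\<Sum>j\<in>Basis. (v \<bullet> j) *\<^sub>R j)" by (simp add: euclidean_representation)
  also have "\<dots> = (\<Sum>j\<in>Basis. (v \<bullet> j) *\<^sub>R h j)"
    by (simp add: linear_sum[OF assms] linear_scale[OF assms])
  finally show ?thesis .
qed

lemma Ck_on_compose:
  fixes f :: "'e::euclidean_space \<Rightarrow> 'b::real_normed_vector"
    and g :: "'d::euclidean_space \<Rightarrow> 'e"
  assumes "open S" "g ` S \<subseteq> T" "Ck_on k T f" "Ck_on k S g"
  shows "Ck_on k S (\<lambda>x. f (g x))"
  using assms(3,4)
proof (induction k arbitrary: f)
  case 0
  then show ?case using assms(2) by (auto intro: continuous_on_compose2)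
next
  case (Suc k)
  let ?D = "\<lambda>z. frechet_derivative f (at z)"
  let ?E = "\<lambda>x. frechet_derivative g (at x)"
  have Df: "(f has_derivative ?D (g x)) (at (g x))" if "x \<in> S" for x
    using Ck_on_Suc_has_derivative[OF Suc.prems(1)] assms(2) that by blast
  show ?case
  proof (rule Ck_on_SucI[OF assms(1)])
    show "((\<lambda>x. f (g x)) has_derivative (\<lambda>v. ?D (g x) (?E x v))) (at x)" if "x \<in> S" for x
      using has_derivative_compose[OF Ck_on_Suc_has_derivative[OF Suc.prems(2) that] Df[OF that]] .
    fix v
    \<comment> \<open>The direction \<open>?E x v\<close> moves with \<open>x\<close>, whereas the
      induction hypothesis covers derivatives of \<open>f\<close> in a fixed direction. Linearity
      reduces to the basis directions.\<close>
    have "Ck_on k S (\<lambda>x. \<Sum>j\<in>Basis. (?E x v \<bullet> j) *\<^sub>R ?D (g x) j)"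
      using Suc.prems Ck_on_SucD[OF Suc.prems(2)]
      by (intro Ck_on_sum Ck_on_scaleR assms(1) Suc.IH
          Ck_on_bounded_linear_compose[OF bounded_linear_inner_left]) auto
    then show "Ck_on k S (\<lambda>x. ?D (g x) (?E x v))"
      by (rule Ck_on_cong[OF assms(1), rotated])
        (use Df linear_eq_sum_Basis has_derivative_linear in metis)
  qed
qed

section \<open>From finite order to infinitely differentiable functions\<close>

lemma smooth_on_subset: "smooth_on S f \<Longrightarrow> T \<subseteq> S \<Longrightarrow> smooth_on T f"
  by (simp add: smooth_on_def Ck_on_subset[of _ S f T])

lemma smooth_on_cong:
  "open S \<Longrightarrow> (\<And>x. x \<in> S \<Longrightarrow> f x = g x) \<Longrightarrow> smooth_on S f \<Longrightarrow> smooth_on S g"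
  by (simp add: smooth_on_def Ck_on_cong[of S f g])

lemma smooth_on_compose:
  "open S \<Longrightarrow> g ` S \<subseteq> T \<Longrightarrow> smooth_on T f \<Longrightarrow> smooth_on S g \<Longrightarrow> smooth_on S (\<lambda>x. f (g x))"
  by (simp add: smooth_on_def Ck_on_compose[of S g T _ f])

lemma smooth_on_has_derivative:
  "smooth_on S f \<Longrightarrow> x \<in> S \<Longrightarrow> (f has_derivative frechet_derivative f (at x)) (at x)"
  unfolding smooth_on_def using Ck_on_Suc_has_derivative[of 0 S f x] by blast

lemma smooth_on_frechet_derivative:
  "smooth_on S f \<Longrightarrow> smooth_on S (\<lambda>x. frechet_derivative f (at x) v)"
  unfolding smooth_on_def using Ck_on.simps(2)[of _ S f] by blast

lemma smooth_on_continuous: "smooth_on S f \<Longrightarrow> continuous_on S f"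
  unfolding smooth_on_def using Ck_on.simps(1)[of S f] by blast

lemma smooth_on_const: "open S \<Longrightarrow> smooth_on S (\<lambda>x. c)"
  by (simp add: smooth_on_def Ck_on_const)

lemma smooth_on_bounded_linear: "bounded_linear h \<Longrightarrow> open S \<Longrightarrow> smooth_on S h"
  by (simp add: smooth_on_def Ck_on_bounded_linear)

lemma smooth_on_add:
  "open S \<Longrightarrow> smooth_on S f \<Longrightarrow> smooth_on S g \<Longrightarrow> smooth_on S (\<lambda>x. f x + g x)"
  by (simp add: smooth_on_def Ck_on_add)

lemma smooth_on_sum:
  "open S \<Longrightarrow> (\<And>i. i \<in> I \<Longrightarrow> smooth_on S (f i)) \<Longrightarrow> smooth_on S (\<lambda>x. \<Sum>i\<in>I. f i x)"
  by (simp add: smooth_on_def Ck_on_sum)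

lemma smooth_on_mult:
  fixes f g :: "_ \<Rightarrow> real"
  shows "open S \<Longrightarrow> smooth_on S f \<Longrightarrow> smooth_on S g \<Longrightarrow> smooth_on S (\<lambda>x. f x * g x)"
  unfolding smooth_on_def using Ck_on_scaleR[of S _ f g] by simp

section \<open>Hadamard's lemma by integration along segments\<close>

lemma convex_segment_point:
  fixes x :: "'e::real_vector"
  assumes "convex S" "x0 \<in> S" "x \<in> S" "t \<in> {0..1}"
  shows "x0 + t *\<^sub>R (x - x0) \<in> S"
proof -
  have "x0 + t *\<^sub>R (x - x0) = (1 - t) *\<^sub>R x0 + t *\<^sub>R x" by (simp add: algebra_simps)
  then show ?thesis using assms by (simp add: convexD_alt)
qed

text \<open>The weight \<open>P\<close> makes the statement stable under differentiation, which
  multiplies the weight by \<open>t\<close>.\<close>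

lemma Ck_on_segment_integral:
  fixes F :: "'e::euclidean_space \<Rightarrow> real"
  assumes S: "open S" "convex S" "x0 \<in> S"
    and "smooth_on S F" "continuous_on {0..1} P"
  shows "Ck_on k S (\<lambda>x. integral {0..1} (\<lambda>t. P t * F (x0 + t *\<^sub>R (x - x0))))"
  using assms(4,5)
proof (induction k arbitrary: F P)
  case 0
  have "continuous_on (S \<times> cbox 0 1) (\<lambda>(x, t::real). P t * F (x0 + t *\<^sub>R (x - x0)))"
    unfolding case_prod_beta
    using convex_segment_point[OF S(2,3)]
    by (intro continuous_intros continuous_on_compose2[OF 0(2)]
        continuous_on_compose2[OF smooth_on_continuous[OF 0(1)]]) auto
  from integral_continuous_on_param[OF this] show ?case by simp
next
  case (Suc k)
  let ?z = "\<lambda>x t. x0 + t *\<^sub>R (x - x0)"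
  let ?D = "\<lambda>z. frechet_derivative F (at z)"
  \<comment> \<open>The x-derivative of the integrand as a bounded linear map, the form in which
    \<open>leibniz_rule\<close> takes it. The factor \<open>t\<close> is the derivative of the
    segment point in \<open>x\<close>. In finite dimension, joint continuity of \<open>B\<close> can
    be tested on basis vectors.\<close>
  define B where "B = (\<lambda>x t. (P t * t) *\<^sub>R Blinfun (?D (?z x t)))"
  have D: "(F has_derivative ?D (?z x t)) (at (?z x t))" if "x \<in> S" "t \<in> {0..1}" for x t
    using smooth_on_has_derivative[OF Suc.prems(1)] convex_segment_point[OF S(2,3) that] by blast
  have B: "blinfun_apply (B x t) v = P t * t * ?D (?z x t) v" if "x \<in> S" "t \<in> {0..1}" for x t v
    unfolding B_def
    by (simp add: scaleR_blinfun.rep_eq bounded_linear_Blinfun_apply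
        has_derivative_bounded_linear[OF D[OF that]])
  have cB: "continuous_on (S \<times> cbox 0 1) (\<lambda>(x, t). B x t)"
  proof (rule continuous_on_blinfun_componentwise)
    fix i :: 'e
    have "continuous_on (S \<times> cbox 0 1) (\<lambda>(x, t). P t * t * ?D (?z x t) i)"
      unfolding case_prod_beta
      using convex_segment_point[OF S(2,3)]
      by (intro continuous_intros continuous_on_compose2[OF Suc.prems(2)]
          continuous_on_compose2[OF smooth_on_continuous[OF
              smooth_on_frechet_derivative[OF Suc.prems(1)]], of _ "\<lambda>x. ?z (fst x) (snd x)"]) auto
    then show "continuous_on (S \<times> cbox 0 1) (\<lambda>x. blinfun_apply (case x of (x, t) \<Rightarrow> B x t) i)"
      by (rule continuous_on_eq) (auto simp: B)
  qed
  have deriv: "((\<lambda>x. integral (cbox 0 1) (\<lambda>t. P t * F (?z x t))) has_derivative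
      blinfun_apply (integral (cbox 0 1) (B x))) (at x within S)" if "x \<in> S" for x
  proof (rule leibniz_rule[OF _ _ cB that S(2)])
    fix x and t :: real assume xt: "x \<in> S" "t \<in> cbox 0 1"
    have "((\<lambda>x. F (?z x t)) has_derivative (\<lambda>v. ?D (?z x t) (t *\<^sub>R v))) (at x)"
      by (rule has_derivative_compose[where f = "\<lambda>x. ?z x t" and g = F, OF _ D])
        (use xt in \<open>auto intro!: derivative_eq_intros\<close>)
    moreover have "?D (?z x t) (t *\<^sub>R v) = t * ?D (?z x t) v" for v
      using linear_scale[OF has_derivative_linear[OF D]] xt by simp
    ultimately have "((\<lambda>x. P t * F (?z x t)) has_derivative (\<lambda>v. P t * (t * ?D (?z x t) v))) (at x)"
      by (auto intro: has_derivative_mult_right)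
    moreover have "blinfun_apply (B x t) = (\<lambda>v. P t * (t * ?D (?z x t) v))"
      using B[OF xt(1)] xt(2) by (simp add: fun_eq_iff mult.assoc)
    ultimately show "((\<lambda>x. P t * F (?z x t)) has_derivative blinfun_apply (B x t)) (at x within S)"
      by (simp add: has_derivative_at_withinI)
  next
    fix x assume "x \<in> S"
    then show "(\<lambda>t. P t * F (?z x t)) integrable_on cbox 0 1"
      using convex_segment_point[OF S(2,3)] Suc.prems(2)
      by (intro integrable_continuous continuous_intros
          continuous_on_compose2[OF smooth_on_continuous[OF Suc.prems(1)]]) auto
  qed
  \<comment> \<open>Evaluation at \<open>v\<close> commutes with the integral. What results has the
    shape of the induction hypothesis, with weight \<open>P t * t\<close> and the derivative of
    \<open>F\<close> along \<open>v\<close> in place of \<open>F\<close>.\<close>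
  have app: "blinfun_apply (integral (cbox 0 1) (B x)) v
      = integral {0..1} (\<lambda>t. P t * t * ?D (?z x t) v)" if "x \<in> S" for x v
  proof -
    have "continuous_on (cbox 0 1) (\<lambda>t. case (x, t) of (x, t) \<Rightarrow> B x t)"
      by (rule continuous_on_compose2[OF cB]) (use that in \<open>auto intro!: continuous_intros\<close>)
    then have "B x integrable_on cbox 0 1" by (intro integrable_continuous) simp
    then have "blinfun_apply (integral (cbox 0 1) (B x)) v
        = integral (cbox 0 1) (\<lambda>t. blinfun_apply (B x t) v)"
      by (rule blinfun_apply_integral)
    also have "\<dots> = integral {0..1} (\<lambda>t. P t * t * ?D (?z x t) v)"
      using B[OF that] by (auto intro!: integral_cong)
    finally show ?thesis .
  qed
  show ?case
  proof (rule Ck_on_SucI[OF S(1)])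
    show "((\<lambda>x. integral {0..1} (\<lambda>t. P t * F (?z x t))) has_derivative
      blinfun_apply (integral (cbox 0 1) (B x))) (at x)" if "x \<in> S" for x
      using deriv[OF that] at_within_open[OF that S(1)] by simp
    fix v
    have "Ck_on k S (\<lambda>x. integral {0..1} (\<lambda>t. P t * t * ?D (?z x t) v))"
      by (rule Suc.IH[OF smooth_on_frechet_derivative[OF Suc.prems(1)]])
        (intro continuous_intros Suc.prems(2))
    then show "Ck_on k S (\<lambda>x. blinfun_apply (integral (cbox 0 1) (B x)) v)"
      by (rule Ck_on_cong[OF S(1), rotated]) (simp only: app)
  qed
qed

text \<open>The fundamental theorem of calculus on the segment from \<open>x0\<close> to
  \<open>x\<close> gives the difference as an integral of derivatives in direction
  \<open>x - x0\<close>; expanding that direction in the basis produces the factors.\<close>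

lemma Hadamard_decomposition:
  fixes F :: "'e::euclidean_space \<Rightarrow> real"
  assumes S: "open S" "convex S" "x0 \<in> S" and F: "smooth_on S F"
  obtains G where "\<And>i. smooth_on S (G i)"
    and "\<And>x. x \<in> S \<Longrightarrow> F x = F x0 + (\<Sum>i\<in>Basis. ((x - x0) \<bullet> i) * G i x)"
    and "\<And>i. G i x0 = frechet_derivative F (at x0) i"
proof
  let ?D = "\<lambda>z. frechet_derivative F (at z)"
  \<comment> \<open>The factor 1 is the initial weight for \<open>Ck_on_segment_integral\<close>. At
    \<open>x0\<close> the segment degenerates and the integrand is constant, which gives the value
    of \<open>G i x0\<close>.\<close>
  define G where "G = (\<lambda>i x. integral {0..1} (\<lambda>t::real. 1 * ?D (x0 + t *\<^sub>R (x - x0)) i))"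
  show "smooth_on S (G i)" for i
    unfolding G_def smooth_on_def
    using Ck_on_segment_integral[OF S smooth_on_frechet_derivative[OF F] continuous_on_const]
    by blast
  show "G i x0 = ?D x0 i" for i by (simp add: G_def)
  fix x assume x: "x \<in> S"
  let ?z = "\<lambda>t::real. x0 + t *\<^sub>R (x - x0)"
  have z: "?z t \<in> S" if "t \<in> {0..1}" for t using convex_segment_point[OF S(2,3) x that] .
  have "((\<lambda>t. F (?z t)) has_vector_derivative ?D (?z t) (x - x0)) (at t within {0..1})"
    if "t \<in> {0..1}" for t
  proof -
    have lin: "linear (?D (?z t))"
      using smooth_on_has_derivative[OF F z[OF that]] has_derivative_linear by blast
    have "((\<lambda>t. F (?z t)) has_derivative (\<lambda>s. ?D (?z t) (s *\<^sub>R (x - x0)))) (at t)"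
      by (rule has_derivative_compose[where f = ?z and g = F,
            OF _ smooth_on_has_derivative[OF F z[OF that]]])
        (auto intro!: derivative_eq_intros)
    then show ?thesis
      unfolding has_vector_derivative_def linear_scale[OF lin] by (rule has_derivative_at_withinI)
  qed
  then have "((\<lambda>t. ?D (?z t) (x - x0)) has_integral F (?z 1) - F (?z 0)) {0..1}"
    by (intro fundamental_theorem_of_calculus) auto
  then have "F x - F x0 = integral {0..1} (\<lambda>t. ?D (?z t) (x - x0))"
    by (simp add: integral_unique)
  also have "\<dots> = integral {0..1} (\<lambda>t. \<Sum>i\<in>Basis. ((x - x0) \<bullet> i) * ?D (?z t) i)"
    using linear_eq_sum_Basis[OF has_derivative_linear[OF smooth_on_has_derivative[OF F z]],
        of _ "x - x0"]
    by (intro integral_cong) simp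
  also have "\<dots> = (\<Sum>i\<in>Basis. ((x - x0) \<bullet> i) * G i x)"
  proof -
    have "(\<lambda>t. ?D (?z t) i) integrable_on {0..1}" for i
      by (intro integrable_continuous_real continuous_intros
          continuous_on_compose2[OF smooth_on_continuous[OF smooth_on_frechet_derivative[OF F]]])
        (use z in auto)
    then show ?thesis unfolding G_def
      by (subst integral_sum) (auto intro: integrable_on_mult_right)
  qed
  finally show "F x = F x0 + (\<Sum>i\<in>Basis. ((x - x0) \<bullet> i) * G i x)" by simp
qed

section \<open>Tangent vectors in coordinates\<close>

lemma tangent_space_add:
  "v \<in> tangent_space A p \<Longrightarrow> smooth_at A f p \<Longrightarrow> smooth_at A g p \<Longrightarrow>
    v (\<lambda>q. f q + g q) = v f + v g"
  by (simp add: tangent_space_def)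

lemma tangent_space_cmult:
  "v \<in> tangent_space A p \<Longrightarrow> smooth_at A f p \<Longrightarrow> v (\<lambda>q. c * f q) = c * v f"
  by (simp add: tangent_space_def)

lemma tangent_space_mult:
  "v \<in> tangent_space A p \<Longrightarrow> smooth_at A f p \<Longrightarrow> smooth_at A g p \<Longrightarrow>
    v (\<lambda>q. f q * g q) = f p * v g + g p * v f"
  by (simp add: tangent_space_def)

lemma tangent_space_not_smooth: "v \<in> tangent_space A p \<Longrightarrow> \<not> smooth_at A f p \<Longrightarrow> v f = 0"
  by (simp add: tangent_space_def)

lemma tangent_space_diff:
  "v \<in> tangent_space A p \<Longrightarrow> w \<in> tangent_space A p \<Longrightarrow> (\<lambda>f. v f - w f) \<in> tangent_space A p"
  by (auto simp: tangent_space_def algebra_simps)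

text \<open>Read in a chart, a function is evaluated only at values of
  \<open>inv_into U \<phi>\<close> on the image of \<open>U\<close>, and these are covered
  points.\<close>

lemma smooth_at_cong:
  assumes "\<And>r. r \<in> points A \<Longrightarrow> f r = g r" "smooth_at A f p"
  shows "smooth_at A g p"
  unfolding smooth_at_def
proof clarify
  fix U \<phi> assume U: "(U, \<phi>) \<in> A" "p \<in> U"
  then obtain W where W: "open W" "\<phi> p \<in> W" "W \<subseteq> \<phi> ` U" "smooth_on W (f \<circ> inv_into U \<phi>)"
    using assms(2) unfolding smooth_at_def by blast
  have "inv_into U \<phi> x \<in> points A" if "x \<in> W" for x
    using W(3) that U(1) inv_into_into[of x \<phi> U] unfolding points_def by force
  then have "smooth_on W (g \<circ> inv_into U \<phi>)"
    using smooth_on_cong[OF W(1) _ W(4)] assms(1) by simp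
  then show "\<exists>W. open W \<and> \<phi> p \<in> W \<and> W \<subseteq> \<phi> ` U \<and> smooth_on W (g \<circ> inv_into U \<phi>)"
    using W by blast
qed

lemma smooth_at_combine:
  assumes "\<And>W F G. open W \<Longrightarrow> smooth_on W F \<Longrightarrow> smooth_on W G \<Longrightarrow>
      smooth_on W (\<lambda>x::'e::euclidean_space. h (F x) (G x))"
    and f: "smooth_at A f p" and g: "smooth_at (A :: ('a, 'e) chart set) g p"
  shows "smooth_at A (\<lambda>q. h (f q) (g q)) p"
  unfolding smooth_at_def
proof clarify
  fix U \<phi> assume U: "(U, \<phi>) \<in> A" "p \<in> U"
  obtain V where V: "open V" "\<phi> p \<in> V" "V \<subseteq> \<phi> ` U" "smooth_on V (f \<circ> inv_into U \<phi>)"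
    using f U unfolding smooth_at_def by blast
  obtain W where W: "open W" "\<phi> p \<in> W" "smooth_on W (g \<circ> inv_into U \<phi>)"
    using g U unfolding smooth_at_def by blast
  have "smooth_on (V \<inter> W) (\<lambda>x. h ((f \<circ> inv_into U \<phi>) x) ((g \<circ> inv_into U \<phi>) x))"
    by (rule assms(1)) (use V(1,4) W(1,3) smooth_on_subset in blast)+
  then show "\<exists>W. open W \<and> \<phi> p \<in> W \<and> W \<subseteq> \<phi> ` U \<and>
      smooth_on W ((\<lambda>q. h (f q) (g q)) \<circ> inv_into U \<phi>)"
    using V(1-3) W(1,2) by (intro exI[of _ "V \<inter> W"]) (auto simp: o_def)
qed

lemma smooth_at_add:
  "smooth_at A f p \<Longrightarrow> smooth_at A g p \<Longrightarrow> smooth_at A (\<lambda>q. f q + g q) p"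
  by (rule smooth_at_combine[where h = "(+)"]) (rule smooth_on_add)

lemma smooth_at_mult:
  "smooth_at A f p \<Longrightarrow> smooth_at A g p \<Longrightarrow> smooth_at A (\<lambda>q. f q * g q) p"
  by (rule smooth_at_combine[where h = "(*)"]) (rule smooth_on_mult)

lemma smooth_at_cmult: "smooth_at A f p \<Longrightarrow> smooth_at A (\<lambda>q. c * f q) p"
  by (rule smooth_at_combine[where h = "\<lambda>a b. c * a" and g = f])
    (rule smooth_on_mult[OF _ smooth_on_const])

text \<open>Here \<open>h\<close> plays the role of the indicator function of \<open>f \<noteq> 0\<close>.\<close>

lemma tangent_vector_local:
  assumes "v \<in> tangent_space A p" "smooth_at A h p" "h p = 0" "f p = 0"
    and "\<And>q. f q = h q * f q"
  shows "v f = 0"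
proof (cases "smooth_at A f p")
  case True
  have "v f = v (\<lambda>q. h q * f q)" using assms(5) by metis
  also have "\<dots> = 0" using tangent_space_mult[OF assms(1,2) True] assms(3,4) by simp
  finally show ?thesis .
qed (rule tangent_space_not_smooth[OF assms(1)])

text \<open>On the covered points the indicator of \<open>f q \<noteq> 0\<close> agrees with
  \<open>f\<close>, so it is as smooth as \<open>f\<close>. This serves for the functions g(X, Y),
  which are known to vanish only on the slit bundle.\<close>

lemma tangent_vector_vanishing:
  assumes "v \<in> tangent_space A p" "p \<in> points A" "\<And>q. q \<in> points A \<Longrightarrow> f q = 0"
  shows "v f = 0"
proof (cases "smooth_at A f p")
  case True
  show ?thesis
  proof (rule tangent_vector_local[OF assms(1), where h = "\<lambda>q. if f q = 0 then 0 else 1"])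
    show "smooth_at A (\<lambda>q. if f q = 0 then 0 else 1) p"
      by (rule smooth_at_cong[OF _ True]) (simp add: assms(3))
  qed (auto simp: assms)
qed (rule tangent_space_not_smooth[OF assms(1)])

section \<open>Change of charts and the coordinate formula for derivations\<close>

context smooth_manifold
begin

lemma chart_inj:
  assumes "(U, \<phi>) \<in> A"
  shows "inj_on \<phi> U"
proof -
  have "topspace (subtopology M U) = U"
    using openin_subset[OF chart_domain[OF assms]] by (simp add: Int_absorb1)
  then show ?thesis using homeomorphic_imp_injective_map[OF chart_homeo[OF assms]] by simp
qed

lemma open_chart_overlap:
  assumes "(U, \<phi>) \<in> A" "(V, \<psi>) \<in> A"
  shows "open (\<phi> ` (U \<inter> V))"
proof -
  have "openin (subtopology M U) (U \<inter> V)"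
    using chart_domain[OF assms(2)] by (metis inf_commute openin_subtopology_Int)
  then have "openin (top_of_set (\<phi> ` U)) (\<phi> ` (U \<inter> V))"
    using homeomorphic_imp_open_map[OF chart_homeo[OF assms(1)]] unfolding open_map_def by blast
  then show ?thesis using chart_image[OF assms(1)] openin_open_trans by blast
qed

text \<open>\<open>smooth_at\<close> quantifies over all charts at \<open>p\<close>; the smooth
  transition maps carry smoothness from one chart to every other, on the preimage \<open>W'\<close>
  of \<open>W\<close>.\<close>

lemma smooth_at_from_chart:
  assumes U: "(U, \<phi>) \<in> A" "p \<in> U"
    and W: "open W" "\<phi> p \<in> W" "W \<subseteq> \<phi> ` U" "smooth_on W (f \<circ> inv_into U \<phi>)"
  shows "smooth_at A f p"
  unfolding smooth_at_def
proof clarify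
  fix V \<psi> assume V: "(V, \<psi>) \<in> A" "p \<in> V"
  let ?T = "\<phi> \<circ> inv_into V \<psi>"
  let ?O = "\<psi> ` (V \<inter> U)"
  have O: "open ?O" and T: "smooth_on ?O ?T"
    using open_chart_overlap[OF V(1) U(1)] chart_compatible[OF V(1) U(1)] by auto
  have inv: "inv_into V \<psi> (\<psi> q) = q" if "q \<in> V" for q
    using chart_inj[OF V(1)] that by (rule inv_into_f_f)
  have inv': "inv_into U \<phi> (\<phi> q) = q" if "q \<in> U" for q
    using chart_inj[OF U(1)] that by (rule inv_into_f_f)
  define W' where "W' = ?T -` W \<inter> ?O"
  have W': "open W'"
    using continuous_on_open_vimage[OF O] smooth_on_continuous[OF T] W(1)
    unfolding W'_def by blast
  have "smooth_on W' (\<lambda>x. (f \<circ> inv_into U \<phi>) (?T x))"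
    by (rule smooth_on_compose[OF W' _ W(4) smooth_on_subset[OF T]]) (auto simp: W'_def)
  then have "smooth_on W' (f \<circ> inv_into V \<psi>)"
    by (rule smooth_on_cong[OF W', rotated]) (auto simp: W'_def inv inv')
  moreover have "\<psi> p \<in> W'" "W' \<subseteq> \<psi> ` V" using U V W(2) inv unfolding W'_def by auto
  ultimately show "\<exists>W. open W \<and> \<psi> p \<in> W \<and> W \<subseteq> \<psi> ` V \<and> smooth_on W (f \<circ> inv_into V \<psi>)"
    using W' by blast
qed

lemma smooth_at_chart_function:
  assumes U: "(U, \<phi>) \<in> A" "p \<in> U"
    and W: "open W" "\<phi> p \<in> W" "W \<subseteq> \<phi> ` U" and G: "smooth_on W G"
  shows "smooth_at A (\<lambda>q. G (\<phi> q)) p"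
proof (rule smooth_at_from_chart[OF U W])
  show "smooth_on W ((\<lambda>q. G (\<phi> q)) \<circ> inv_into U \<phi>)"
    by (rule smooth_on_cong[OF W(1) _ G]) (use W(3) in \<open>auto simp: f_inv_into_f subset_iff\<close>)
qed

text \<open>Derivations see only germs: the difference \<open>k\<close> vanishes near
  \<open>p\<close>, so the indicator of its support is locally zero, hence smooth, and
  \<open>tangent_vector_local\<close> applies. The form \<open>f q + (-1) * g q\<close> fits the
  linearity clauses of \<open>tangent_space\<close>.\<close>

lemma tangent_vector_cong:
  assumes U: "(U, \<phi>) \<in> A" "p \<in> U"
    and W: "open W" "\<phi> p \<in> W" "W \<subseteq> \<phi> ` U"
    and v: "v \<in> tangent_space A p" and f: "smooth_at A f p" and g: "smooth_at A g p"
    and eq: "\<And>q. q \<in> U \<Longrightarrow> \<phi> q \<in> W \<Longrightarrow> f q = g q"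
  shows "v f = v g"
proof -
  define k where "k = (\<lambda>q. f q + (-1) * g q)"
  define h where "h = (\<lambda>q. if k q = 0 then 0 else 1 :: real)"
  have "smooth_on W (\<lambda>x. 0::real)" by (rule smooth_on_const[OF W(1)])
  then have "smooth_on W (h \<circ> inv_into U \<phi>)"
    by (rule smooth_on_cong[OF W(1), rotated])
      (use W(3) in \<open>auto simp: h_def k_def eq inv_into_into f_inv_into_f subset_iff\<close>)
  then have "smooth_at A h p" by (rule smooth_at_from_chart[OF U W])
  then have "v k = 0"
    by (rule tangent_vector_local[OF v]) (use eq[OF U(2) W(2)] in \<open>auto simp: h_def k_def\<close>)
  moreover have "v k = v f - v g"
    unfolding k_def
    using tangent_space_add[OF v f smooth_at_cmult[OF g, of "-1"]]
      tangent_space_cmult[OF v g, of "-1"]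
    by simp
  ultimately show ?thesis by simp
qed

lemma tangent_vector_const:
  assumes p: "p \<in> topspace M" and v: "v \<in> tangent_space A p"
  shows "smooth_at A (\<lambda>q. c) p" "v (\<lambda>q. c) = 0"
proof -
  show s: "smooth_at A (\<lambda>q. c) p" for c
  proof -
    obtain U \<phi> where U: "(U, \<phi>) \<in> A" "p \<in> U" using p unfolding chart_cover[symmetric] by auto
    have "smooth_on (\<phi> ` U) (\<lambda>x. c)"
      by (rule smooth_on_const[OF chart_image[OF U(1)]])
    from smooth_at_chart_function[OF U chart_image[OF U(1)] _ _ this] U(2) show ?thesis by simp
  qed
  have "v (\<lambda>q. 1) = 0" using tangent_space_mult[OF v s[of 1] s[of 1]] by simp
  then show "v (\<lambda>q. c) = 0" using tangent_space_cmult[OF v s[of 1], of c] by simp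
qed

text \<open>Smoothness is assumed for all subsums, so that the induction has it for single summands
  and for remainders alike.\<close>

lemma tangent_vector_sum:
  assumes p: "p \<in> topspace M" and v: "v \<in> tangent_space A p"
    and "finite I" "\<And>J. J \<subseteq> I \<Longrightarrow> smooth_at A (\<lambda>q. \<Sum>i\<in>J. f i q) p"
  shows "v (\<lambda>q. \<Sum>i\<in>I. f i q) = (\<Sum>i\<in>I. v (f i))"
  using assms(3,4)
proof (induction I rule: finite_induct)
  case empty
  then show ?case using tangent_vector_const[OF p v] by simp
next
  case (insert i I)
  have "smooth_at A (f i) p" using insert.prems[of "{i}"] by simp
  moreover have "smooth_at A (\<lambda>q. \<Sum>i\<in>I. f i q) p" using insert.prems[of I] by auto
  moreover have "v (\<lambda>q. \<Sum>i\<in>I. f i q) = (\<Sum>i\<in>I. v (f i))"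
    using insert.IH insert.prems by blast
  ultimately show ?case using insert.hyps tangent_space_add[OF v, of "f i"] by simp
qed

text \<open>The components of a tangent vector in a chart; the same expression is the fibre part of
  \<open>slit_chart\<close>.\<close>

definition coordinates :: "('a \<Rightarrow> 'e) \<Rightarrow> 'a tvec \<Rightarrow> 'e" where
  "coordinates \<phi> v = (\<Sum>i\<in>Basis. v (\<lambda>q. \<phi> q \<bullet> i) *\<^sub>R i)"

text \<open>The Hadamard decomposition of \<open>f\<close> in a chart reduces \<open>v f\<close> to the values of \<open>v\<close> on the
  coordinate functions.\<close>

lemma tangent_vector_coordinates:
  assumes U: "(U, \<phi>) \<in> A" "p \<in> U" and v: "v \<in> tangent_space A p" and f: "smooth_at A f p"
  shows "v f = frechet_derivative (f \<circ> inv_into U \<phi>) (at (\<phi> p)) (coordinates \<phi> v)"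
proof -
  let ?F = "f \<circ> inv_into U \<phi>"
  have p: "p \<in> topspace M" using U unfolding chart_cover[symmetric] by force
  have inv: "inv_into U \<phi> (\<phi> q) = q" if "q \<in> U" for q
    using chart_inj[OF U(1)] that by (rule inv_into_f_f)
  obtain W where W: "open W" "\<phi> p \<in> W" "W \<subseteq> \<phi> ` U" "smooth_on W ?F"
    using f U unfolding smooth_at_def by blast
  then obtain r where r: "r > 0" "ball (\<phi> p) r \<subseteq> W" using open_contains_ball by blast
  \<comment> \<open>A ball, because the Hadamard decomposition integrates over segments and so needs
    a convex domain.\<close>
  let ?B = "ball (\<phi> p) r"
  have B: "open ?B" "\<phi> p \<in> ?B" "?B \<subseteq> \<phi> ` U" "smooth_on ?B ?F"
    using r W smooth_on_subset by auto
  obtain G where G: "\<And>i. smooth_on ?B (G i)"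
    "\<And>x. x \<in> ?B \<Longrightarrow> ?F x = ?F (\<phi> p) + (\<Sum>i\<in>Basis. ((x - \<phi> p) \<bullet> i) * G i x)"
    "\<And>i. G i (\<phi> p) = frechet_derivative ?F (at (\<phi> p)) i"
    using Hadamard_decomposition[OF B(1) convex_ball B(2,4)] by blast
  note sm = smooth_at_chart_function[OF U B(1-3)]
  have lin: "smooth_on ?B (\<lambda>x. x \<bullet> i)" for i
    by (rule smooth_on_bounded_linear[OF bounded_linear_inner_left B(1)])
  have aff: "smooth_on ?B (\<lambda>x. x \<bullet> i + - (\<phi> p \<bullet> i))" for i
    by (intro smooth_on_add smooth_on_const lin B(1))
  \<comment> \<open>The summands of the Hadamard remainder. The first factor vanishes at
    \<open>p\<close>, so the product rule leaves \<open>G i (\<phi> p)\<close>, a partial derivative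
    of \<open>?F\<close>, times \<open>v\<close> of the coordinate function.\<close>
  define e where "e = (\<lambda>i q. (\<phi> q \<bullet> i + - (\<phi> p \<bullet> i)) * G i (\<phi> q))"
  have se: "smooth_at A (\<lambda>q. \<Sum>i\<in>J. e i q) p" for J
  proof -
    have "smooth_on ?B (\<lambda>x. \<Sum>i\<in>J. (x \<bullet> i + - (\<phi> p \<bullet> i)) * G i x)"
      by (intro smooth_on_sum smooth_on_mult aff G(1) B(1))
    from sm[OF this] show ?thesis by (simp add: e_def)
  qed
  have ve: "v (e i) = v (\<lambda>q. \<phi> q \<bullet> i) * frechet_derivative ?F (at (\<phi> p)) i" for i
  proof -
    have "v (e i) = G i (\<phi> p) * v (\<lambda>q. \<phi> q \<bullet> i + - (\<phi> p \<bullet> i))"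
      unfolding e_def using tangent_space_mult[OF v sm[OF aff[of i]] sm[OF G(1)[of i]]] by simp
    also have "v (\<lambda>q. \<phi> q \<bullet> i + - (\<phi> p \<bullet> i)) = v (\<lambda>q. \<phi> q \<bullet> i)"
      using tangent_space_add[OF v sm[OF lin[of i]] tangent_vector_const(1)[OF p v]]
        tangent_vector_const(2)[OF p v] by (simp del: add_uminus_conv_diff)
    finally show ?thesis by (simp add: G(3))
  qed
  have sfe: "smooth_at A (\<lambda>q. f p + (\<Sum>i\<in>Basis. e i q)) p"
  proof -
    have "smooth_on ?B (\<lambda>x. f p + (\<Sum>i\<in>Basis. (x \<bullet> i + - (\<phi> p \<bullet> i)) * G i x))"
      by (intro smooth_on_add smooth_on_const smooth_on_sum smooth_on_mult aff G(1) B(1))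
    from sm[OF this] show ?thesis by (simp add: e_def)
  qed
  have "v f = v (\<lambda>q. f p + (\<Sum>i\<in>Basis. e i q))"
  proof (rule tangent_vector_cong[OF U B(1-3) v f sfe])
    fix q assume "q \<in> U" "\<phi> q \<in> ?B"
    then show "f q = f p + (\<Sum>i\<in>Basis. e i q)"
      using G(2)[of "\<phi> q"] U(2) by (simp add: inv e_def inner_diff_left)
  qed
  also have "\<dots> = v (\<lambda>q. \<Sum>i\<in>Basis. e i q)"
    using tangent_space_add[OF v tangent_vector_const(1)[OF p v] se]
      tangent_vector_const(2)[OF p v] by simp
  also have "\<dots> = (\<Sum>i\<in>Basis. v (e i))"
    by (rule tangent_vector_sum[OF p v finite_Basis se])
  also have "\<dots> = frechet_derivative ?F (at (\<phi> p)) (coordinates \<phi> v)"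
  proof -
    have l: "linear (frechet_derivative ?F (at (\<phi> p)))"
      using smooth_on_has_derivative[OF B(4,2)] has_derivative_linear by blast
    show ?thesis
      by (simp add: coordinates_def linear_sum[OF l] linear_scale[OF l] ve)
  qed
  finally show ?thesis .
qed

text \<open>By the coordinate formula, equal components force equal values on smooth functions; on
  all others both vectors are 0 by convention.\<close>

lemma slit_chart_inj:
  assumes U: "(U, \<phi>) \<in> A"
  shows "inj_on (snd (slit_chart A (U, \<phi>))) (fst (slit_chart A (U, \<phi>)))"
proof (rule inj_onI, clarsimp)
  fix p v q w
  assume *: "p \<in> U" "q \<in> U" "v \<in> tangent_space A p" "w \<in> tangent_space A q" "\<phi> p = \<phi> q"
    "(\<Sum>i\<in>Basis. v (\<lambda>q. \<phi> q \<bullet> i) *\<^sub>R i) = (\<Sum>i\<in>Basis. w (\<lambda>q. \<phi> q \<bullet> i) *\<^sub>R i)"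
  have pq: "p = q" using chart_inj[OF U] * by (auto dest: inj_onD)
  have "v f = w f" for f
  proof (cases "smooth_at A f p")
    case True
    have "coordinates \<phi> v = coordinates \<phi> w" using *(6) by (simp add: coordinates_def)
    then show ?thesis
      using tangent_vector_coordinates[OF U *(1,3) True] pq
        tangent_vector_coordinates[OF U *(2,4), of f] True by simp
  next
    case False
    then show ?thesis using tangent_space_not_smooth * pq by metis
  qed
  then show "p = q \<and> v = w" using pq by auto
qed

end

section \<open>Horizontal lifts\<close>

context finsler_manifold
begin

text \<open>The smoothness of \<open>L\<close> at \<open>u\<close> already contains the fact that the image of a slit chart is a
  neighbourhood of the image of \<open>u\<close>.\<close>

lemma slit_chart_neighbourhood:
  assumes "(U', \<Phi>) \<in> slit_atlas A" "u \<in> U'"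
  obtains W where "open W" "\<Phi> u \<in> W" "W \<subseteq> \<Phi> ` U'"
proof -
  have "u \<in> slit_bundle A" using assms points_slit_atlas[of A] unfolding points_def by force
  from L_smooth[OF this] show ?thesis
    using that assms unfolding smooth_at_def by blast
qed

lemma fst_inv_slit_chart:
  assumes U: "(U, \<phi>) \<in> A" and "slit_chart A (U, \<phi>) = (U', \<Phi>)" "z \<in> \<Phi> ` U'"
  shows "fst (inv_into U' \<Phi> z) = inv_into U \<phi> (fst z)"
proof -
  obtain r where r: "r \<in> U'" "\<Phi> r = z" "inv_into U' \<Phi> z = r"
    using assms(3) inv_into_into[of z \<Phi> U'] f_inv_into_f[of z \<Phi> U'] by blast
  then have "fst r \<in> U" "\<phi> (fst r) = fst z" using assms(2) by auto
  then show ?thesis using r(3) chart_inj[OF U] inv_into_f_eq by metis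
qed

text \<open>In a slit chart the projection is the linear map \<open>fst\<close>, so a lifted
  function is constant along fibres and the component \<open>b\<close> drops out of its
  derivative.\<close>

lemma smooth_on_lift:
  assumes U: "(U, \<phi>) \<in> A" and \<Phi>: "slit_chart A (U, \<phi>) = (U', \<Phi>)"
    and u: "u \<in> U'" and f: "smooth_at A f (fst u)"
  obtains W where "open W" "\<Phi> u \<in> W" "W \<subseteq> \<Phi> ` U'"
    and "smooth_on W ((f \<circ> fst) \<circ> inv_into U' \<Phi>)"
    and "frechet_derivative ((f \<circ> fst) \<circ> inv_into U' \<Phi>) (at (\<Phi> u)) (a, b)
      = frechet_derivative (f \<circ> inv_into U \<phi>) (at (\<phi> (fst u))) a"
proof -
  let ?F = "f \<circ> inv_into U \<phi>"
  have mem: "(U', \<Phi>) \<in> slit_atlas A" using U \<Phi> unfolding slit_atlas_def by (metis imageI)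
  have fu: "fst u \<in> U" "fst (\<Phi> u) = \<phi> (fst u)" using u \<Phi> by auto
  obtain W1 where W1: "open W1" "\<Phi> u \<in> W1" "W1 \<subseteq> \<Phi> ` U'"
    using slit_chart_neighbourhood[OF mem u] by blast
  obtain W2 where W2: "open W2" "\<phi> (fst u) \<in> W2" "smooth_on W2 ?F"
    using f U fu unfolding smooth_at_def by blast
  let ?W = "W1 \<inter> W2 \<times> UNIV"
  have W: "open ?W" "\<Phi> u \<in> ?W" "?W \<subseteq> \<Phi> ` U'"
    using W1 W2 fu by (auto simp: open_Times mem_Times_iff)
  have eq: "?F (fst z) = ((f \<circ> fst) \<circ> inv_into U' \<Phi>) z" if "z \<in> ?W" for z
    using fst_inv_slit_chart[OF U \<Phi> subsetD[OF W(3) that]] by simp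
  have "smooth_on ?W (\<lambda>z. ?F (fst z))"
    by (rule smooth_on_compose[OF W(1) _ W2(3)])
      (auto intro!: smooth_on_bounded_linear bounded_linear_fst W(1))
  then have s: "smooth_on ?W ((f \<circ> fst) \<circ> inv_into U' \<Phi>)"
    by (rule smooth_on_cong[OF W(1), rotated]) (fact eq)
  have "((\<lambda>z. ?F (fst z)) has_derivative
      (\<lambda>z. frechet_derivative ?F (at (\<phi> (fst u))) (fst z))) (at (\<Phi> u))"
    by (rule has_derivative_compose[OF has_derivative_fst[OF has_derivative_ident]])
      (use smooth_on_has_derivative[OF W2(3,2)] fu in \<open>simp add: o_def\<close>)
  then have "(((f \<circ> fst) \<circ> inv_into U' \<Phi>) has_derivative
      (\<lambda>z. frechet_derivative ?F (at (\<phi> (fst u))) (fst z))) (at (\<Phi> u))"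
    by (rule has_derivative_transform_within_open[OF _ W(1,2)]) (fact eq)
  from frechet_derivative_at[OF this] have
    "frechet_derivative ((f \<circ> fst) \<circ> inv_into U' \<Phi>) (at (\<Phi> u)) (a, b)
      = frechet_derivative ?F (at (\<phi> (fst u))) a" by (metis fst_conv)
  then show ?thesis using that[OF W s] by blast
qed

lemma smooth_at_lift:
  assumes "smooth_at A f (fst u)"
  shows "smooth_at (slit_atlas A) (f \<circ> fst) u"
  unfolding smooth_at_def
proof clarify
  fix U' \<Phi> assume "(U', \<Phi>) \<in> slit_atlas A" and u: "u \<in> U'"
  then obtain U \<phi> where "(U, \<phi>) \<in> A" "slit_chart A (U, \<phi>) = (U', \<Phi>)"
    unfolding slit_atlas_def by force
  from smooth_on_lift[OF this u assms]
  show "\<exists>W. open W \<and> \<Phi> u \<in> W \<and> W \<subseteq> \<Phi> ` U' \<and> smooth_on W ((f \<circ> fst) \<circ> inv_into U' \<Phi>)"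
    by metis
qed

text \<open>The lift is a directional derivative in a slit chart; on the base it becomes the
  derivative along \<open>coordinates \<phi> w\<close>, which is \<open>w\<close> by
  \<open>tangent_vector_coordinates\<close>.\<close>

lemma rho_surj:
  assumes u: "u \<in> slit_bundle A" and w: "w \<in> tangent_space A (fst u)"
  obtains \<xi> where "\<xi> \<in> tangent_space (slit_atlas A) u" "rho A u \<xi> = w"
proof -
  obtain U \<phi> where U: "(U, \<phi>) \<in> A" "fst u \<in> U"
    using u unfolding slit_bundle_def points_def by force
  obtain U' \<Phi> where \<Phi>: "slit_chart A (U, \<phi>) = (U', \<Phi>)" by fastforce
  have u': "u \<in> U'" using u U \<Phi> unfolding slit_bundle_def by auto
  have mem: "(U', \<Phi>) \<in> slit_atlas A" using U \<Phi> unfolding slit_atlas_def by (metis imageI)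
  have inv: "inv_into U' \<Phi> (\<Phi> u) = u"
    using slit_chart_inj[OF U(1)] \<Phi> u' by (simp add: inv_into_f_f)
  let ?B = "slit_atlas A"
  let ?F = "\<lambda>g. g \<circ> inv_into U' \<Phi>"
  \<comment> \<open>The fibre component 0 is a free choice: by \<open>smooth_on_lift\<close> it does
    not influence the projection.\<close>
  let ?d = "\<lambda>g. frechet_derivative (?F g) (at (\<Phi> u)) (coordinates \<phi> w, 0)"
  define \<xi> where "\<xi> = (\<lambda>g. if smooth_at ?B g u then ?d g else 0)"
  have D: "(?F g has_derivative frechet_derivative (?F g) (at (\<Phi> u))) (at (\<Phi> u))"
    if "smooth_at ?B g u" for g
    using that mem u' smooth_on_has_derivative unfolding smooth_at_def by blast
  have "\<xi> \<in> tangent_space ?B u"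
    unfolding tangent_space_def
  proof (intro CollectI conjI allI impI)
    fix f g assume f: "smooth_at ?B f u" and g: "smooth_at ?B g u"
    have "(?F (\<lambda>q. f q + g q) has_derivative (\<lambda>z. frechet_derivative (?F f) (at (\<Phi> u)) z
        + frechet_derivative (?F g) (at (\<Phi> u)) z)) (at (\<Phi> u))"
      using has_derivative_add[OF D[OF f] D[OF g]] by (simp add: o_def)
    from frechet_derivative_at[OF this, symmetric]
    show "\<xi> (\<lambda>q. f q + g q) = \<xi> f + \<xi> g" using f g smooth_at_add[OF f g] by (simp add: \<xi>_def)
    have "(?F (\<lambda>q. f q * g q) has_derivative
        (\<lambda>z. f u * frechet_derivative (?F g) (at (\<Phi> u)) z
          + frechet_derivative (?F f) (at (\<Phi> u)) z * g u)) (at (\<Phi> u))"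
      using has_derivative_mult[OF D[OF f] D[OF g]] by (simp add: o_def inv)
    from frechet_derivative_at[OF this, symmetric]
    show "\<xi> (\<lambda>q. f q * g q) = f u * \<xi> g + g u * \<xi> f"
      using f g smooth_at_mult[OF f g] by (simp add: \<xi>_def)
  next
    fix c f assume f: "smooth_at ?B f u"
    have "(?F (\<lambda>q. c * f q) has_derivative
        (\<lambda>z. c * frechet_derivative (?F f) (at (\<Phi> u)) z)) (at (\<Phi> u))"
      using has_derivative_mult_right[OF D[OF f]] by (simp add: o_def)
    from frechet_derivative_at[OF this, symmetric]
    show "\<xi> (\<lambda>q. c * f q) = c * \<xi> f" using f smooth_at_cmult[OF f] by (simp add: \<xi>_def)
  qed (simp add: \<xi>_def)
  moreover have "rho A u \<xi> f = w f" for f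
  proof (cases "smooth_at A f (fst u)")
    case True
    have "rho A u \<xi> f = ?d (f \<circ> fst)"
      using True smooth_at_lift[OF True] by (simp add: rho_def tangent_map_def \<xi>_def)
    also have "\<dots> = frechet_derivative (f \<circ> inv_into U \<phi>) (at (\<phi> (fst u))) (coordinates \<phi> w)"
      using smooth_on_lift[OF U(1) \<Phi> u' True] by metis
    also have "\<dots> = w f" using tangent_vector_coordinates[OF U w True] by simp
    finally show ?thesis .
  next
    case False
    then show ?thesis
      using tangent_space_not_smooth[OF w] by (simp add: rho_def tangent_map_def)
  qed
  ultimately show ?thesis using that by blast
qed

text \<open>Splitting any lift of \<open>w\<close>, the vertical part is killed by
  \<open>rho\<close>, so the horizontal part is again a lift. Thus \<open>w\<close> lies in the
  image on which \<open>inv_into\<close> is a true right inverse.\<close>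

lemma beta_horizontal_lift:
  assumes D: "regular_connection A D"
    and u: "u \<in> slit_bundle A" and w: "w \<in> tangent_space A (fst u)"
  shows "beta A D u w \<in> tangent_space (slit_atlas A) u" "rho A u (beta A D u w) = w"
proof -
  obtain \<xi> where \<xi>: "\<xi> \<in> tangent_space (slit_atlas A) u" "rho A u \<xi> = w"
    using rho_surj[OF u w] .
  then obtain \<nu> \<zeta> where *: "\<xi> = (\<lambda>h. \<nu> h + \<zeta> h)" "\<nu> \<in> vertical_space A u"
    "\<zeta> \<in> horizontal_space A D u"
    using D u unfolding regular_connection_def by blast
  have "rho A u \<xi> = (\<lambda>f. rho A u \<nu> f + rho A u \<zeta> f)"
    unfolding *(1) rho_def tangent_map_def by auto
  moreover have "rho A u \<nu> = (\<lambda>_. 0)" using *(2) by (simp add: vertical_space_def)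
  ultimately have "rho A u \<zeta> = w" using \<xi>(2) by simp
  then have im: "w \<in> rho A u ` horizontal_space A D u" using *(3) by blast
  show "beta A D u w \<in> tangent_space (slit_atlas A) u"
    using inv_into_into[OF im] by (simp add: beta_def horizontal_space_def)
  show "rho A u (beta A D u w) = w" using f_inv_into_f[OF im] by (simp add: beta_def)
qed

end

section \<open>Sections of the pullback bundle and h-involutivity\<close>

lemma pi_vector_field_tangent:
  "pi_vector_field A Y \<Longrightarrow> u \<in> slit_bundle A \<Longrightarrow> Y u \<in> tangent_space A (fst u)"
  by (simp add: pi_vector_field_def vector_field_along_def points_slit_atlas)

lemma pi_vector_field_cong:
  assumes "pi_vector_field A Y" "\<And>u. u \<in> slit_bundle A \<Longrightarrow> Y u = Z u"
  shows "pi_vector_field A Z"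
  unfolding pi_vector_field_def vector_field_along_def
proof (intro ballI conjI allI impI)
  fix u assume u: "u \<in> points (slit_atlas A)"
  then show "Z u \<in> tangent_space A (fst u)"
    using assms pi_vector_field_tangent by (metis points_slit_atlas)
  fix f assume "smooth_at A f (fst u)"
  then have "smooth_at (slit_atlas A) (\<lambda>r. Y r f) u"
    using assms(1) u by (simp add: pi_vector_field_def vector_field_along_def)
  then show "smooth_at (slit_atlas A) (\<lambda>r. Z r f) u"
    by (rule smooth_at_cong[rotated]) (simp add: assms(2) points_slit_atlas)
qed

theorem theorem2p14:
  fixes M :: "'a topology" and A :: "('a, 'e::euclidean_space) chart set"
    and L :: "'a tpoint \<Rightarrow> real" and D :: "'a pi_connection" and X :: "'a pi_field"
  assumes "finsler_manifold M A L"
    and "cartan_connection A L D"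
    and "pi_vector_field A X"
    and "dbar_closed A L D X"
  shows "h_involutive A D (pi_distribution A L X)"
  unfolding h_involutive_def belongs_to_def
proof (intro allI impI ballI)
  interpret finsler_manifold M A L by (rule assms(1))
  fix Y Z u
  assume Y: "pi_vector_field A Y" and Z: "pi_vector_field A Z" and u: "u \<in> slit_bundle A"
    and YD: "\<forall>u\<in>slit_bundle A. Y u \<in> pi_distribution A L X u"
    and ZD: "\<forall>u\<in>slit_bundle A. Z u \<in> pi_distribution A L X u"
  let ?b = "\<lambda>Y w. beta A D w (Y w)"
  let ?R = "rho A u (lie_bracket (slit_atlas A) (?b Y) (?b Z) u)"
  have reg: "regular_connection A D" and lin: "linear_connection A D"
    using assms(2) by (auto simp: cartan_connection_def regular_connection_def)
  note lift = beta_horizontal_lift[OF reg]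
  have b: "?b V u \<in> tangent_space (slit_atlas A) u" if "pi_vector_field A V" for V
    using lift(1)[OF u] pi_vector_field_tangent[OF that u] by blast
  \<comment> \<open>The torsion differentiates \<open>rho\<close> of \<open>beta V\<close>, not
    \<open>V\<close> itself. The two agree only over the slit bundle, which is enough for the
    connection axioms to apply.\<close>
  have rb: "pi_vector_field A (\<lambda>w. rho A w (?b V w))" if "pi_vector_field A V" for V
    by (rule pi_vector_field_cong[OF that])
      (simp add: lift(2) pi_vector_field_tangent[OF that])
  have D: "D u (?b V u) (\<lambda>w. rho A w (?b V' w)) \<in> tangent_space A (fst u)"
    if "pi_vector_field A V" "pi_vector_field A V'" for V V'
    using lin[unfolded linear_connection_def, THEN conjunct1] u b[OF that(1)] rb[OF that(2)]
    by blast
  have "torsion_hh A D Y Z u = (\<lambda>_. 0)"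
    using assms(2) Y Z u by (simp add: cartan_connection_def)
  then have "?R = (\<lambda>f. D u (?b Y u) (\<lambda>w. rho A w (?b Z w)) f
      - D u (?b Z u) (\<lambda>w. rho A w (?b Y w)) f)"
    unfolding torsion_hh_def torsion_def fun_eq_iff by (simp add: algebra_simps)
  then have R: "?R \<in> tangent_space A (fst u)"
    using tangent_space_diff[OF D[OF Y Z] D[OF Z Y]] by simp
  \<comment> \<open>This removes both derivative terms of \<open>dbar\<close>, leaving only the
    value of the form on \<open>?R\<close>.\<close>
  have van: "?b V u (\<lambda>w. finsler_metric L w (X w) (V' w)) = 0"
    if "pi_vector_field A V" "\<forall>u\<in>slit_bundle A. V' u \<in> pi_distribution A L X u" for V V'
    by (rule tangent_vector_vanishing[OF b[OF that(1)]])
      (use u that(2) in \<open>auto simp: points_slit_atlas pi_distribution_def\<close>)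
  have "dbar A D (\<lambda>w. finsler_metric L w (X w)) Y Z u = 0"
    using assms(4) Y Z u by (simp add: dbar_closed_def)
  then have "finsler_metric L u (X u) ?R = 0"
    unfolding dbar_def using van[OF Y ZD] van[OF Z YD] by simp
  then show "?R \<in> pi_distribution A L X u" using R by (simp add: pi_distribution_def)
qed

end
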